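(* Let $K$ be a compact Hausdorff space and let $f\in C(K,\mathbb{E}^1)$. Then there exists a function $F_0\in C(K)$ such that $$D(f,C(K))=D(f,F_0),$$ where $D(f,F)$, for $F\in C(K)$, is the distance measured on the cores of the fuzzy numbers $f(x)$, and $D(f,C(K))=\inf_{F\in C(K)}D(f,F)$.
   Context: A fuzzy subset of $\mathbb{R}$ is a function $u:\mathbb{R}\to[0,1]$. Its $\lambda$-level sets are $[u]^\lambda:=\{x\in\mathbb{R}: u(x)\ge\lambda\}$ for $\lambda\in(0,1]$, and $[u]^0$ is the closure of $\{x\in\mathbb{R}:u(x)>0\}$. The fuzzy number space $\mathbb{E}^1$ is the set of all fuzzy subsets $u$ of $\mathbb{R}$ such that: (1) $u$ is normal, i.e. there is $x_0\in\mathbb{R}$ with $u(x_0)=1$; (2) $u$ is convex, i.e. $u(\lambda x+(1-\lambda)y)\ge\min\{u(x),u(y)\}$ for all $x,y\in\mathbb{R}$, $\lambda\in[0,1]$; (3) $u$ is upper semicontinuous; (4) $[u]^0$ is compact. For $u\in\mathbb{E}^1$ and every $\lambda\in[0,1]$ the level set $[u]^\lambda$ is a compact interval, written $[u]^\lambda=[u^-(\lambda),u^+(\lambda)]$. For $f$ with values in $\mathbb{E}^1$, write $[f(x)]^\lambda=[f(x)^-(\lambda),f(x)^+(\lambda)]$; the interval $[f(x)^-(1),f(x)^+(1)]$ is the core of $f(x)$. $\mathbb{E}^1$ is equipped with the supremum metric $$d_\infty(u,v):=\sup_{\lambda\in[0,1]}\max\{|u^-(\lambda)-v^-(\lambda)|,\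 |u^+(\lambda)-v^+(\lambda)|\}.$$ $C(K,\mathbb{E}^1)$ denotes the set of continuous functions from $K$ to $(\mathbb{E}^1,d_\infty)$, and $C(K)$ denotes the set of continuous real-valued functions on $K$. For $f\in C(K,\mathbb{E}^1)$ and $F\in C(K)$, the distance between $f$ and $F$ is $$D(f,F):=\sup_{x\in K}\Bigl\{\sup\{|F(x)-t|:\ t\in[f(x)^-(1),f(x)^+(1)]\}\Bigr\},$$ and the distance between $f$ and $C(K)$ is $$D(f,C(K)):=\inf_{F\in C(K)}D(f,F).$$ *)

theory Defs
  imports "HOL-Analysis.Analysis"
begin

definition level_set :: "(real \<Rightarrow> real) \<Rightarrow> real \<Rightarrow> real set" where
  "level_set u l = (if l = 0 then closure {x. u x > 0} else {x. u x \<ge> l})"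

definition upper_semicontinuous :: "(real \<Rightarrow> real) \<Rightarrow> bool" where
  "upper_semicontinuous u \<longleftrightarrow> (\<forall>x c. u x < c \<longrightarrow> (\<forall>\<^sub>F y in nhds x. u y < c))"

definition is_fuzzy_number :: "(real \<Rightarrow> real) \<Rightarrow> bool" where
  "is_fuzzy_number u \<longleftrightarrow>
     range u \<subseteq> {0..1} \<and>
     (\<exists>x0. u x0 = 1) \<and>
     (\<forall>x y. \<forall>l\<in>{0..1}. u (l * x + (1 - l) * y) \<ge> min (u x) (u y)) \<and>
     upper_semicontinuous u \<and>
     compact (level_set u 0)"

typedef fuzzy_number = "{u. is_fuzzy_number u}"
  morphisms membership Abs_fuzzy_number
proof -
  define u :: "real \<Rightarrow> real" where "u = indicator {0}"
  have u: "u x = (if x = 0 then 1 else 0)" for x by (simp add: u_def)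
  have "level_set u 0 = {0}"
    by (simp add: level_set_def u)
  moreover have "range u \<subseteq> {0..1}" "u 0 = 1" by (auto simp: u)
  moreover have "min (u x) (u y) \<le> u (l * x + (1 - l) * y)" for x y l
    by (cases "x = 0"; cases "y = 0") (simp_all add: u)
  moreover have "upper_semicontinuous u"
    unfolding upper_semicontinuous_def
  proof (intro allI impI)
    fix x c :: real
    assume c: "u x < c"
    show "\<forall>\<^sub>F y in nhds x. u y < c"
    proof (cases "x = 0")
      case True
      then have "u y < c" for y using c by (simp add: u split: if_splits)
      then show ?thesis by (intro always_eventually) blast
    next
      case False
      then have "\<forall>\<^sub>F y in nhds x. y \<in> - {0}"
        by (intro eventually_nhds_in_open) auto
      then show ?thesis by eventually_elim (use c False u in simp)
    qed
  qed
  ultimately have "is_fuzzy_number u"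
    unfolding is_fuzzy_number_def by (metis compact_sing)
  then show ?thesis by blast
qed

text \<open>The end points of the \<open>l\<close>-level set of a fuzzy number, which is the interval
  between them by \<open>level_set_eq_interval\<close> below.\<close>

definition lower_end :: "fuzzy_number \<Rightarrow> real \<Rightarrow> real" where
  "lower_end u l = Inf (level_set (membership u) l)"

definition upper_end :: "fuzzy_number \<Rightarrow> real \<Rightarrow> real" where
  "upper_end u l = Sup (level_set (membership u) l)"

lemma level_set_mono:
  assumes "l \<in> {0..1}"
  shows "level_set u l \<subseteq> level_set u 0"
proof (cases "l = 0")
  case False
  then have "{x. u x \<ge> l} \<subseteq> {x. u x > 0}" using assms by auto
  then show ?thesis using False closure_subset[of "{x. u x > 0}"] by (simp add: level_set_def)
qed simp

lemma
  assumes l: "l \<in> {0..1}"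
  shows level_set_eq_interval: "level_set (membership u) l = {lower_end u l..upper_end u l}"
    and lower_end_le_upper_end: "lower_end u l \<le> upper_end u l"
proof -
  define v where "v = membership u"
  have v: "is_fuzzy_number v" using membership by (auto simp: v_def)
  then obtain x0 where "v x0 = 1" by (auto simp: is_fuzzy_number_def)
  have cv: "min (v x) (v y) \<le> v (k * x + (1 - k) * y)" if "k \<in> {0..1}" for x y k
    using v that by (auto simp: is_fuzzy_number_def)
  have usc: "upper_semicontinuous v" and comp: "compact (level_set v 0)"
    using v by (auto simp: is_fuzzy_number_def)
  have ne: "level_set v l \<noteq> {}"
  proof -
    have "v x0 > 0" "v x0 \<ge> l" using \<open>v x0 = 1\<close> l by auto
    then have "x0 \<in> level_set v l"
      using closure_subset[of "{x. v x > 0}"] by (auto simp: level_set_def)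
    then show ?thesis by blast
  qed
  have conv: "convex {x. P (v x)}" if "\<And>a b. P a \<Longrightarrow> a \<le> b \<Longrightarrow> P b" for P
  proof (rule convexI)
    fix x y s t :: real
    assume "x \<in> {x. P (v x)}" "y \<in> {x. P (v x)}" and st: "0 \<le> s" "0 \<le> t" "s + t = 1"
    then have "P (min (v x) (v y))" by (auto simp: min_def)
    moreover have "t = 1 - s" using st by simp
    ultimately show "s *\<^sub>R x + t *\<^sub>R y \<in> {x. P (v x)}"
      using that[OF _ cv[of s x y]] st(1,2) by simp
  qed
  have "convex (level_set v l)"
    using conv[of "\<lambda>a. a > 0"] conv[of "\<lambda>a. a \<ge> l"] by (simp add: level_set_def convex_closure)
  moreover have "closed (level_set v l)"
  proof (cases "l = 0")
    case False
    have "open {x. v x < l}"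
    proof (subst open_subopen, rule ballI)
      fix x assume "x \<in> {x. v x < l}"
      then have "\<forall>\<^sub>F y in nhds x. v y < l"
        using usc by (simp add: upper_semicontinuous_def)
      then show "\<exists>T. open T \<and> x \<in> T \<and> T \<subseteq> {x. v x < l}"
        by (auto simp: eventually_nhds)
    qed
    moreover have "{x. v x < l} = - level_set v l"
      using False by (auto simp: level_set_def)
    ultimately show ?thesis by (simp add: closed_def)
  qed (simp add: level_set_def)
  then have "compact (level_set v l)"
    using comp level_set_mono[OF l, of v] by (metis compact_Int_closed inf.absorb_iff2)
  ultimately obtain a b where ab: "level_set v l = {a..b}"
    using connected_compact_interval_1[of "level_set v l"] convex_connected by blast
  moreover have "a \<le> b" using ne ab by simp
  ultimately show "level_set (membership u) l = {lower_end u l..upper_end u l}"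
    "lower_end u l \<le> upper_end u l"
    by (simp_all add: lower_end_def upper_end_def flip: v_def)
qed

definition end_dist :: "fuzzy_number \<Rightarrow> fuzzy_number \<Rightarrow> real \<Rightarrow> real" where
  "end_dist u v l = max \<bar>lower_end u l - lower_end v l\<bar> \<bar>upper_end u l - upper_end v l\<bar>"

lemma bdd_above_end_dist: "bdd_above (end_dist u v ` {0..1})"
proof (rule bdd_aboveI2)
  fix l :: real
  assume l: "l \<in> {0..1}"
  have *: "lower_end w 0 \<le> lower_end w l" "lower_end w l \<le> upper_end w l"
    "upper_end w l \<le> upper_end w 0" for w
    using level_set_mono[OF l, of "membership w"] lower_end_le_upper_end[OF l, of w]
    by (auto simp: level_set_eq_interval[OF l] level_set_eq_interval[of 0])
  show "end_dist u v l \<le> \<bar>lower_end u 0\<bar> + \<bar>upper_end u 0\<bar> + \<bar>lower_end v 0\<bar> + \<bar>upper_end v 0\<bar>"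
    using *[of u] *[of v] unfolding end_dist_def by linarith
qed

text \<open>The metric is the supremum metric on the end points of the level sets.\<close>

instantiation fuzzy_number :: metric_space
begin

definition dist_fuzzy_number :: "fuzzy_number \<Rightarrow> fuzzy_number \<Rightarrow> real" where
  "dist u v = (SUP l\<in>{0..1}. end_dist u v l)"

definition uniformity_fuzzy_number :: "(fuzzy_number \<times> fuzzy_number) filter" where
  "(uniformity :: (fuzzy_number \<times> fuzzy_number) filter) =
     (INF e\<in>{0<..}. principal {(u, v). dist u v < e})"

definition open_fuzzy_number :: "fuzzy_number set \<Rightarrow> bool" where
  "open (U :: fuzzy_number set) \<longleftrightarrow>
     (\<forall>u\<in>U. \<forall>\<^sub>F (u', v) in uniformity. u' = u \<longrightarrow> v \<in> U)"

instance
proof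
  show "uniformity = (INF e\<in>{0<..}. principal {(u, v::fuzzy_number). dist u v < e})"
    by (rule uniformity_fuzzy_number_def)
  show "open U \<longleftrightarrow> (\<forall>u\<in>U. \<forall>\<^sub>F (u', v) in uniformity. u' = u \<longrightarrow> v \<in> U)"
    for U :: "fuzzy_number set"
    by (rule open_fuzzy_number_def)
next
  fix u v w :: fuzzy_number
  have le: "end_dist a b l \<le> dist a b" if "l \<in> {0..1}" for a b l
    unfolding dist_fuzzy_number_def by (rule cSUP_upper[OF that bdd_above_end_dist])
  show "dist u v \<le> dist u w + dist v w"
    unfolding dist_fuzzy_number_def[of u v]
  proof (rule cSUP_least)
    fix l :: real
    assume l: "l \<in> {0..1}"
    show "end_dist u v l \<le> dist u w + dist v w"
      using le[OF l, of u w] le[OF l, of v w] unfolding end_dist_def by linarith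
  qed simp
  show "dist u v = 0 \<longleftrightarrow> u = v"
  proof
    assume d: "dist u v = 0"
    have eq: "level_set (membership u) l = level_set (membership v) l" if "l \<in> {0..1}" for l
    proof -
      have "end_dist u v l \<le> 0" using le[OF that, of u v] d by simp
      then have "lower_end u l = lower_end v l" "upper_end u l = upper_end v l"
        unfolding end_dist_def by linarith+
      then show ?thesis by (simp add: level_set_eq_interval[OF that])
    qed
    have rng: "membership a x \<in> {0..1}" for a x
      using membership[of a] by (force simp: is_fuzzy_number_def image_subset_iff)
    have le_iff: "l \<le> membership u x \<longleftrightarrow> l \<le> membership v x" if "l \<in> {0<..1}" for l x
      using eq[of l] that by (auto simp: level_set_def set_eq_iff)
    have "membership u x = membership v x" for x
      using le_iff[of "membership u x" x] le_iff[of "membership v x" x] rng[of u x] rng[of v x]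
      by (cases "membership u x > 0"; cases "membership v x > 0") auto
    then show "u = v" by (simp add: fun_eq_iff flip: membership_inject)
  qed (simp add: dist_fuzzy_number_def end_dist_def)
qed

end

text \<open>For continuous \<open>f\<close>, \<open>F\<close> on a nonempty compact \<open>K\<close> the suprema are over nonempty
  bounded sets. For empty \<open>K\<close> the value is the unspecified real \<open>Sup {}\<close>, independent of \<open>F\<close>.\<close>

definition core_dist :: "'a topology \<Rightarrow> ('a \<Rightarrow> fuzzy_number) \<Rightarrow> ('a \<Rightarrow> real) \<Rightarrow> real" where
  "core_dist K f F =
     (SUP x\<in>topspace K. SUP t\<in>{lower_end (f x) 1..upper_end (f x) 1}. \<bar>F x - t\<bar>)"

definition core_dist_C :: "'a topology \<Rightarrow> ('a \<Rightarrow> fuzzy_number) \<Rightarrow> real" where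
  "core_dist_C K f = (INF F\<in>{F. continuous_map K euclideanreal F}. core_dist K f F)"

end

theory Submission imports Defs begin

text \<open>
  For a fixed point \<open>x\<close>, the largest distance from a real number \<open>y\<close> to a point of the core
  \<open>[a, b]\<close> of \<open>f x\<close> is \<open>\<bar>y - (a + b) / 2\<bar> + (b - a) / 2\<close> (\<open>SUP_abs_diff_Icc\<close>), so the midpoint
  of the core is the best choice of \<open>y\<close>, and it depends on nothing but \<open>f x\<close>. Hence the function
  \<open>core_mid \<circ> f\<close> minimises the distance to \<open>f\<close> at every point simultaneously, and a fortiori the
  supremum over \<open>K\<close>. It belongs to \<open>C(K)\<close> because the supremum metric dominates the distance of
  the end points of the cores (\<open>end_dist_le_dist\<close>). Compactness of \<open>K\<close> makes the pointwise
  distances bounded, so that pointwise comparison carries over to the real suprema.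
\<close>

lemma end_dist_le_dist:
  assumes "l \<in> {0..1}"
  shows "end_dist u v l \<le> dist u v"
  unfolding dist_fuzzy_number_def by (rule cSUP_upper[OF assms bdd_above_end_dist])

lemma
  assumes l: "l \<in> {0..1}"
  shows continuous_on_lower_end: "continuous_on A (\<lambda>u. lower_end u l)"
    and continuous_on_upper_end: "continuous_on A (\<lambda>u. upper_end u l)"
proof -
  have "\<bar>lower_end u l - lower_end v l\<bar> \<le> dist u v" "\<bar>upper_end u l - upper_end v l\<bar> \<le> dist u v"
    for u v
    using end_dist_le_dist[OF l, of u v] by (simp_all add: end_dist_def)
  then show "continuous_on A (\<lambda>u. lower_end u l)" "continuous_on A (\<lambda>u. upper_end u l)"
    unfolding continuous_on_iff dist_real_def by (meson le_less_trans)+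
qed

definition core_mid :: "fuzzy_number \<Rightarrow> real" where
  "core_mid u = (lower_end u 1 + upper_end u 1) / 2"

definition core_radius :: "fuzzy_number \<Rightarrow> real" where
  "core_radius u = (upper_end u 1 - lower_end u 1) / 2"

lemma
  shows continuous_on_core_mid: "continuous_on A core_mid"
    and continuous_on_core_radius: "continuous_on A core_radius"
  unfolding core_mid_def[abs_def] core_radius_def[abs_def]
  by (intro continuous_intros continuous_on_lower_end continuous_on_upper_end; simp)+

text \<open>The point of an interval farthest from \<open>y\<close> is the end point on the other side of the
  midpoint.\<close>

lemma SUP_abs_diff_Icc:
  fixes a b y :: real
  assumes "a \<le> b"
  shows "(SUP t\<in>{a..b}. \<bar>y - t\<bar>) = \<bar>y - (a + b) / 2\<bar> + (b - a) / 2"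
proof (rule cSup_eq_maximum)
  show "\<bar>y - (a + b) / 2\<bar> + (b - a) / 2 \<in> (\<lambda>t. \<bar>y - t\<bar>) ` {a..b}"
  proof (cases "y \<le> (a + b) / 2")
    case True
    then show ?thesis using assms by (intro image_eqI[of _ _ b]) (auto simp: field_simps)
  next
    case False
    then show ?thesis using assms by (intro image_eqI[of _ _ a]) (auto simp: field_simps)
  qed
  show "s \<le> \<bar>y - (a + b) / 2\<bar> + (b - a) / 2" if "s \<in> (\<lambda>t. \<bar>y - t\<bar>) ` {a..b}" for s
    using that by (auto simp: abs_if field_simps)
qed

lemma core_dist_eq_SUP_mid_radius:
  "core_dist K f F = (SUP x\<in>topspace K. \<bar>F x - core_mid (f x)\<bar> + core_radius (f x))"
  by (simp add: core_dist_def core_mid_def core_radius_def SUP_abs_diff_Icc lower_end_le_upper_end)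

lemma bdd_above_continuous_map_image:
  fixes g :: "'a \<Rightarrow> real"
  assumes "compact_space K" and "continuous_map K euclideanreal g"
  shows "bdd_above (g ` topspace K)"
proof -
  have "compactin euclideanreal (g ` topspace K)"
    using assms image_compactin unfolding compact_space_def by blast
  then show ?thesis
    by (simp add: bounded_imp_bdd_above compact_imp_bounded)
qed

lemma continuous_map_core_mid:
  assumes "continuous_map K euclidean f"
  shows "continuous_map K euclideanreal (\<lambda>x. core_mid (f x))"
  using continuous_map_compose[OF assms, of euclideanreal core_mid] continuous_on_core_mid
  by (simp add: o_def)

lemma continuous_map_core_radius:
  assumes "continuous_map K euclidean f"
  shows "continuous_map K euclideanreal (\<lambda>x. core_radius (f x))"
  using continuous_map_compose[OF assms, of euclideanreal core_radius] continuous_on_core_radius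
  by (simp add: o_def)

lemma core_dist_core_mid_le:
  assumes "compact_space K" and f: "continuous_map K euclidean f"
    and F: "continuous_map K euclideanreal F"
  shows "core_dist K f (\<lambda>x. core_mid (f x)) \<le> core_dist K f F"
proof (cases "topspace K = {}")
  case True
  \<comment> \<open>Both sides are the same unspecified real number \<open>Sup {}\<close>.\<close>
  then show ?thesis by (simp add: core_dist_def)
next
  case False
  have "continuous_map K euclideanreal (\<lambda>x. \<bar>F x - core_mid (f x)\<bar> + core_radius (f x))"
    by (intro continuous_intros F continuous_map_core_mid continuous_map_core_radius f)
  then have bdd: "bdd_above ((\<lambda>x. \<bar>F x - core_mid (f x)\<bar> + core_radius (f x)) ` topspace K)"
    by (rule bdd_above_continuous_map_image[OF assms(1)])
  show ?thesis
    unfolding core_dist_eq_SUP_mid_radius by (rule cSUP_mono[OF False bdd], erule bexI[rotated]) simp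
qed

theorem theorem4p7:
  fixes K :: "'a topology" and f :: "'a \<Rightarrow> fuzzy_number"
  assumes "compact_space K" and "Hausdorff_space K"
    and "continuous_map K euclidean f"
  shows "\<exists>F0. continuous_map K euclideanreal F0 \<and> core_dist_C K f = core_dist K f F0"
proof (intro exI conjI)
  show mid: "continuous_map K euclideanreal (\<lambda>x. core_mid (f x))"
    using assms(3) by (rule continuous_map_core_mid)
  show "core_dist_C K f = core_dist K f (\<lambda>x. core_mid (f x))"
    unfolding core_dist_C_def
    using mid core_dist_core_mid_le[OF assms(1,3)] by (intro cInf_eq_minimum) auto
qed

end
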